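(* Let $l$ be a positive integer and let $m$ be a nonnegative integer. For any prime $p$ not dividing $l+1$, we have the congruence $$\sum_{n=1}^{p-1}\frac{(-1)^{mn}}{n^{m-1}}S_l^{(m)}(n)\equiv 0\pmod p.$$
   Context: Notation: $\mathbb N=\{0,1,2,\ldots\}$. For a positive integer $l$ and $m,n\in\mathbb N$, define $$S_l^{(m)}(n):=\sum_{\substack{k_1,\ldots,k_l\in\mathbb N\\ k_1+\cdots+k_l=n}}\binom{n}{k_1,\ldots,k_l}^m,$$ where $\binom{n}{k_1,\ldots,k_l}=\frac{n!}{k_1!\cdots k_l!}$ is the multinomial coefficient. (When $m=0$, every term equals $1$, so $S_l^{(0)}(n)=\binom{l+n-1}{n}$, and $1/n^{m-1}$ means $n$.) The congruence is between rational numbers whose denominators are not divisible by $p$: $a\equiv b\pmod p$ means that $a-b\in p\mathbb Z_{(p)}$, where $\mathbb Z_{(p)}$ is the ring of rational numbers with denominator prime to $p$. *)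

theory Defs
  imports Complex_Main "HOL-Computational_Algebra.Primes"
begin

definition multinomial :: "nat \<Rightarrow> nat list \<Rightarrow> nat" where
  "multinomial n ks = fact n div prod_list (map fact ks)"

text \<open>The division is exact on the lists that occur in the sums below.\<close>

lemma prod_list_fact_dvd:
  "prod_list (map fact ks) dvd (fact (sum_list ks) :: nat)"
proof (induction ks)
  case (Cons k ks)
  have "fact k * prod_list (map fact ks) dvd fact k * (fact (sum_list ks) :: nat)"
    using Cons.IH by (rule mult_dvd_mono[OF dvd_refl])
  also have "\<dots> dvd fact (k + sum_list ks)"
    by (rule fact_fact_dvd_fact)
  finally show ?case by simp
qed simp

lemma of_nat_multinomial:
  assumes "sum_list ks = n"
  shows "of_nat (multinomial n ks) = (fact n / prod_list (map fact ks) :: rat)"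
proof -
  have eq: "of_nat (prod_list (map fact ks)) = (prod_list (map fact ks) :: rat)"
    by (induction ks) auto
  obtain c where c: "fact n = prod_list (map fact ks) * (c :: nat)"
    using prod_list_fact_dvd[of ks] assms by (auto elim: dvdE)
  have nz: "prod_list (map fact ks) \<noteq> (0 :: nat)"
    by (induction ks) auto
  have nz': "prod_list (map fact ks) \<noteq> (0 :: rat)"
    by (induction ks) auto
  have "(fact n :: rat) = prod_list (map fact ks) * of_nat c"
    using arg_cong[OF c, of "of_nat :: nat \<Rightarrow> rat"] by (simp add: eq)
  moreover have "multinomial n ks = c"
    using nz by (simp add: multinomial_def c)
  ultimately show ?thesis
    using nz' by simp
qed

definition weak_compositions :: "nat \<Rightarrow> nat \<Rightarrow> nat list set" where
  "weak_compositions l n = {ks. length ks = l \<and> sum_list ks = n}"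

lemma finite_weak_compositions: "finite (weak_compositions l n)"
proof (rule finite_subset)
  show "weak_compositions l n \<subseteq> {ks. set ks \<subseteq> {..n} \<and> length ks = l}"
    by (auto simp: weak_compositions_def dest: member_le_sum_list)
qed (simp add: finite_lists_length_eq)

definition multinomial_power_sum :: "nat \<Rightarrow> nat \<Rightarrow> nat \<Rightarrow> nat" where
  "multinomial_power_sum l m n = (\<Sum>ks\<in>weak_compositions l n. multinomial n ks ^ m)"

definition localized_ints :: "nat \<Rightarrow> rat set" where
  "localized_ints p = {x. coprime (snd (quotient_of x)) (int p)}"

definition rat_cong :: "nat \<Rightarrow> rat \<Rightarrow> rat \<Rightarrow> bool" where
  "rat_cong p a b \<longleftrightarrow> a - b \<in> (\<lambda>x. of_nat p * x) ` localized_ints p"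

end

theory Submission
  imports Defs "HOL-Number_Theory.Residues"
begin

text \<open>
  By Wilson's theorem \<open>(n - 1)! (p - n)! \<equiv> (-1)\<^sup>n (mod p)\<close>, so, writing \<open>k\<^sub>0 = p - n\<close>, the term
  belonging to \<open>k\<^sub>1, \<dots>, k\<^sub>l\<close> is congruent to \<open>-k\<^sub>0 / (k\<^sub>0! k\<^sub>1! \<cdots> k\<^sub>l!)\<^sup>m\<close>. Hence the sum is
  congruent to the negative of the sum of \<open>k\<^sub>0 / (k\<^sub>0! \<cdots> k\<^sub>l!)\<^sup>m\<close> over all compositions of \<open>p\<close>
  into \<open>l + 1\<close> parts smaller than \<open>p\<close>. By symmetry the weight \<open>k\<^sub>0\<close> may be replaced by any \<open>k\<^sub>i\<close>;
  adding up, \<open>l + 1\<close> times this sum carries the weight \<open>k\<^sub>0 + \<cdots> + k\<^sub>l = p\<close>.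
\<close>

section \<open>Congruences between localized integers\<close>

text \<open>The fraction need not be reduced: the reduced denominator \<open>d\<close> divides
  \<open>c * b\<close> and is coprime to \<open>c\<close>, hence divides \<open>b\<close> and
  inherits coprimality to \<open>p\<close>.\<close>

lemma localized_intsI:
  assumes "coprime b (int p)" and "x = of_int a / of_int b"
  shows "x \<in> localized_ints p"
proof (cases "b = 0")
  case True
  with assms show ?thesis by (simp add: localized_ints_def)
next
  case False
  obtain c d where cd: "quotient_of x = (c, d)" by fastforce
  have d: "d > 0" and co: "coprime c d" and x: "x = of_int c / of_int d"
    using cd by (auto intro: quotient_of_denom_pos quotient_of_coprime quotient_of_div)
  have "of_int (c * b) = (of_int (a * d) :: rat)"
    using x assms(2) d False by (simp add: field_simps)
  then have "c * b = a * d" by (simp only: of_int_eq_iff)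
  then have "d dvd c * b" by simp
  then have "d dvd b"
    using co by (simp add: coprime_commute coprime_dvd_mult_right_iff)
  then have "coprime d (int p)"
    using coprime_divisors[OF _ dvd_refl assms(1)] by simp
  then show ?thesis by (simp add: localized_ints_def cd)
qed

lemma localized_intsE:
  assumes "x \<in> localized_ints p"
  obtains a b where "b > 0" "coprime b (int p)" "x = of_int a / of_int b"
proof -
  obtain c d where cd: "quotient_of x = (c, d)" by fastforce
  show ?thesis
    by (rule that[of d c])
      (use assms cd in \<open>auto simp: localized_ints_def
        intro: quotient_of_denom_pos quotient_of_div\<close>)
qed

lemma of_int_localized [simp]: "of_int a \<in> localized_ints p"
  by (rule localized_intsI[of 1 _ _ a]) auto

lemma of_nat_localized [simp]: "of_nat a \<in> localized_ints p"
  using of_int_localized[of "int a"] by simp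

lemma localized_ints_0 [simp]: "0 \<in> localized_ints p"
  and localized_ints_1 [simp]: "1 \<in> localized_ints p"
  using of_int_localized[of 0] of_int_localized[of 1] by simp_all

lemma inverse_of_nat_localized:
  "coprime b p \<Longrightarrow> inverse (of_nat b) \<in> localized_ints p"
  by (rule localized_intsI[of "int b" _ _ 1]) (auto simp: field_simps)

lemma localized_ints_add:
  assumes "x \<in> localized_ints p" "y \<in> localized_ints p"
  shows "x + y \<in> localized_ints p"
proof -
  from assms(1) obtain a b where 1: "b > 0" "coprime b (int p)" "x = of_int a / of_int b"
    by (rule localized_intsE)
  from assms(2) obtain c d where 2: "d > 0" "coprime d (int p)" "y = of_int c / of_int d"
    by (rule localized_intsE)
  show ?thesis
    by (rule localized_intsI[of "b * d" _ _ "a * d + c * b"])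
      (use 1 2 in \<open>auto simp: field_simps\<close>)
qed

lemma localized_ints_mult:
  assumes "x \<in> localized_ints p" "y \<in> localized_ints p"
  shows "x * y \<in> localized_ints p"
proof -
  from assms(1) obtain a b where 1: "b > 0" "coprime b (int p)" "x = of_int a / of_int b"
    by (rule localized_intsE)
  from assms(2) obtain c d where 2: "d > 0" "coprime d (int p)" "y = of_int c / of_int d"
    by (rule localized_intsE)
  show ?thesis
    by (rule localized_intsI[of "b * d" _ _ "a * c"]) (use 1 2 in auto)
qed

lemma localized_ints_power:
  "x \<in> localized_ints p \<Longrightarrow> x ^ m \<in> localized_ints p"
  by (induction m) (auto intro: localized_ints_mult)

lemma localized_ints_sum:
  "(\<And>i. i \<in> A \<Longrightarrow> f i \<in> localized_ints p) \<Longrightarrow> (\<Sum>i\<in>A. f i) \<in> localized_ints p"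
  by (induction A rule: infinite_finite_induct) (auto intro: localized_ints_add)

lemma rat_cong_iff:
  "rat_cong p a b \<longleftrightarrow> (\<exists>x\<in>localized_ints p. a - b = of_nat p * x)"
  by (auto simp: rat_cong_def)

lemma rat_cong_refl [simp]: "rat_cong p a a"
  unfolding rat_cong_iff by (rule bexI[of _ 0]) auto

text \<open>Carries Wilson's congruence, proved over the integers, into the localization.\<close>

lemma rat_cong_of_int:
  assumes "[a = b] (mod int p)"
  shows "rat_cong p (of_int a) (of_int b)"
proof -
  obtain c where c: "a - b = int p * c"
    using assms by (auto simp: cong_iff_dvd_diff elim: dvdE)
  have "of_int a - of_int b = of_nat p * (of_int c :: rat)"
    using arg_cong[OF c, of "of_int :: int \<Rightarrow> rat"] by simp
  then show ?thesis unfolding rat_cong_iff by (rule bexI) simp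
qed

lemma rat_cong_add:
  assumes "rat_cong p a b" "rat_cong p c d"
  shows "rat_cong p (a + c) (b + d)"
proof -
  obtain x y where "x \<in> localized_ints p" "a - b = of_nat p * x"
    "y \<in> localized_ints p" "c - d = of_nat p * y"
    using assms unfolding rat_cong_iff by blast
  then show ?thesis unfolding rat_cong_iff
    by (intro bexI[of _ "x + y"]) (auto simp: algebra_simps intro: localized_ints_add)
qed

lemma rat_cong_sum:
  "(\<And>i. i \<in> A \<Longrightarrow> rat_cong p (f i) (g i)) \<Longrightarrow> rat_cong p (\<Sum>i\<in>A. f i) (\<Sum>i\<in>A. g i)"
  by (induction A rule: infinite_finite_induct) (auto intro: rat_cong_add)

lemma rat_cong_trans:
  assumes "rat_cong p a b" "rat_cong p b c"
  shows "rat_cong p a c"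
proof -
  obtain x y where "x \<in> localized_ints p" "a - b = of_nat p * x"
    "y \<in> localized_ints p" "b - c = of_nat p * y"
    using assms unfolding rat_cong_iff by blast
  then show ?thesis unfolding rat_cong_iff
    by (intro bexI[of _ "x + y"]) (auto simp: algebra_simps intro: localized_ints_add)
qed

lemma rat_cong_mult_left:
  assumes "rat_cong p a b" "c \<in> localized_ints p"
  shows "rat_cong p (c * a) (c * b)"
proof -
  obtain x where x: "x \<in> localized_ints p" "a - b = of_nat p * x"
    using assms unfolding rat_cong_iff by blast
  have "c * a - c * b = of_nat p * (c * x)"
    using x(2) by (simp flip: right_diff_distrib)
  then show ?thesis unfolding rat_cong_iff
    using localized_ints_mult[OF assms(2) x(1)] by blast
qed

text \<open>The chain is \<open>a * c\<close> \<equiv> \<open>a * d\<close> \<equiv>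
  \<open>b * d\<close>; the multipliers \<open>a\<close> and \<open>d\<close> are therefore the
  numbers assumed localized.\<close>

lemma rat_cong_mult:
  assumes "rat_cong p a b" "rat_cong p c d" "a \<in> localized_ints p" "d \<in> localized_ints p"
  shows "rat_cong p (a * c) (b * d)"
  using rat_cong_trans[OF rat_cong_mult_left[OF assms(2,3)]]
    rat_cong_mult_left[OF assms(1,4)] by (simp add: mult.commute)

lemma rat_cong_power:
  assumes "rat_cong p a b" "a \<in> localized_ints p" "b \<in> localized_ints p"
  shows "rat_cong p (a ^ m) (b ^ m)"
  by (induction m) (auto intro: rat_cong_mult localized_ints_power assms)

lemma rat_cong_0_cancel:
  assumes "rat_cong p (of_nat b * a) 0" "coprime b p" "b > 0"
  shows "rat_cong p a 0"
  using rat_cong_mult_left[OF assms(1) inverse_of_nat_localized[OF assms(2)]] assms(3)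
  by (simp flip: mult.assoc)

section \<open>A variant of Wilson's theorem\<close>

text \<open>The case \<open>n = 0\<close> is Wilson's theorem. Each step moves a factor from the
  second factorial to the first, at the cost of a sign, since \<open>p - Suc n\<close> \<equiv>
  \<open>- Suc n\<close>.\<close>

lemma fact_mult_fact_cong:
  assumes "prime p" "n < p"
  shows "[fact n * fact (p - Suc n) = (-1) ^ Suc n] (mod int p)"
  using assms(2)
proof (induction n)
  case 0
  then show ?case using wilson_theorem[OF assms(1)] by simp
next
  case (Suc n)
  have IH: "[fact n * fact (p - Suc n) = (-1) ^ Suc n] (mod int p)"
    using Suc by simp
  have "p - Suc n = Suc (p - Suc (Suc n))" using Suc.prems by simp
  then have f: "fact (p - Suc n) = int (p - Suc n) * fact (p - Suc (Suc n))"
    by (metis fact_Suc of_nat_fact of_nat_mult)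
  have c: "[- int (Suc n) = int (p - Suc n)] (mod int p)"
    using Suc.prems by (simp add: cong_iff_dvd_diff of_nat_diff)
  \<comment> \<open>The claim is first shown multiplied by \<open>- Suc n\<close>, which avoids
    dividing; this factor is cancelled at the end because 0 < \<open>Suc n\<close> <
    \<open>p\<close>.\<close>
  have "[- int (Suc n) * (fact (Suc n) * fact (p - Suc (Suc n)))
    = int (p - Suc n) * (fact (Suc n) * fact (p - Suc (Suc n)))] (mod int p)"
    using c by (rule cong_scalar_right)
  also have "int (p - Suc n) * (fact (Suc n) * fact (p - Suc (Suc n)))
    = int (Suc n) * (fact n * fact (p - Suc n))"
    unfolding f by simp
  also have "[\<dots> = int (Suc n) * (-1) ^ Suc n] (mod int p)"
    using IH by (rule cong_scalar_left)
  also have "int (Suc n) * (-1) ^ Suc n = - int (Suc n) * (-1) ^ Suc (Suc n)"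
    by (simp only: power_Suc mult_minus_left mult_minus_right mult_1_left)
  finally have *: "[- int (Suc n) * (fact (Suc n) * fact (p - Suc (Suc n)))
    = - int (Suc n) * (-1) ^ Suc (Suc n)] (mod int p)" .
  have "coprime (Suc n) p"
    using prime_nat_not_dvd assms(1) Suc.prems
    by (metis coprime_commute nat_dvd_not_less prime_imp_coprime zero_less_Suc)
  then have "coprime (- int (Suc n)) (int p)"
    by (simp only: coprime_minus_left_iff coprime_int_iff)
  with * show ?case using cong_mult_lcancel by blast
qed

section \<open>Symmetric sums over compositions\<close>

text \<open>For prime \<open>p\<close> the bound keeps all factorials prime to \<open>p\<close>; it
  excludes only lists with one part \<open>p\<close> and zeros elsewhere.\<close>

definition bounded_compositions :: "nat \<Rightarrow> nat \<Rightarrow> nat list set" where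
  "bounded_compositions l p = {ks \<in> weak_compositions l p. \<forall>k\<in>set ks. k < p}"

lemma finite_bounded_compositions: "finite (bounded_compositions l p)"
  by (simp add: bounded_compositions_def finite_weak_compositions)

lemma mset_rotate1: "mset (rotate1 ks) = mset ks"
  by (cases ks) auto

lemma mset_rotate: "mset (rotate i ks) = mset ks"
  by (induction i) (simp_all add: mset_rotate1)

lemma sum_list_rotate: "sum_list (rotate i ks) = sum_list (ks :: 'a :: comm_monoid_add list)"
  by (metis mset_rotate sum_mset_sum_list)

lemma prod_list_map_rotate:
  "prod_list (map f (rotate i ks)) = (prod_list (map f ks) :: 'a :: comm_monoid_mult)"
  by (metis mset_map mset_rotate prod_mset_prod_list)

lemma inj_rotate: "inj (rotate i)"
  unfolding rotate_def by (intro inj_fn inj_rotate1)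

text \<open>An injective self-map of a finite set is onto.\<close>

lemma bij_betw_rotate_bounded_compositions:
  "bij_betw (rotate i) (bounded_compositions l p) (bounded_compositions l p)"
proof -
  have "rotate i ` bounded_compositions l p \<subseteq> bounded_compositions l p"
    by (auto simp: bounded_compositions_def weak_compositions_def sum_list_rotate)
  moreover have "inj_on (rotate i) (bounded_compositions l p)"
    using inj_rotate by (rule inj_on_subset) simp
  ultimately show ?thesis
    by (simp add: bij_betw_def endo_inj_surj finite_bounded_compositions)
qed

text \<open>Cyclic symmetry suffices: rotating by \<open>i\<close> brings entry \<open>i\<close> to
  the front, so every position gives the same weighted sum, and the \<open>l + 1\<close> weights add
  up to \<open>p\<close>.\<close>

lemma sum_hd_bounded_compositions:
  fixes g :: "nat list \<Rightarrow> 'a :: comm_semiring_1"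
  assumes "\<And>i ks. g (rotate i ks) = g ks"
  shows "of_nat (Suc l) * (\<Sum>ks\<in>bounded_compositions (Suc l) p. of_nat (hd ks) * g ks)
    = of_nat p * (\<Sum>ks\<in>bounded_compositions (Suc l) p. g ks)"
proof -
  let ?W = "bounded_compositions (Suc l) p"
  have W: "length ks = Suc l" "sum_list ks = p" if "ks \<in> ?W" for ks
    using that by (auto simp: bounded_compositions_def weak_compositions_def)
  have nth: "(\<Sum>ks\<in>?W. of_nat (hd ks) * g ks) = (\<Sum>ks\<in>?W. of_nat (ks ! i) * g ks)"
    if i: "i < Suc l" for i
  proof -
    have "(\<Sum>ks\<in>?W. of_nat (hd ks) * g ks)
      = (\<Sum>ks\<in>?W. of_nat (hd (rotate i ks)) * g (rotate i ks))"
      by (rule sum.reindex_bij_betw[symmetric, OF bij_betw_rotate_bounded_compositions])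
    also have "\<dots> = (\<Sum>ks\<in>?W. of_nat (ks ! i) * g ks)"
    proof (intro sum.cong refl)
      fix ks assume "ks \<in> ?W"
      then have "length ks = Suc l" by (rule W)
      then have "hd (rotate i ks) = ks ! i"
        using i by (subst hd_rotate_conv_nth) auto
      then show "of_nat (hd (rotate i ks)) * g (rotate i ks) = of_nat (ks ! i) * g ks"
        by (simp add: assms)
    qed
    finally show ?thesis .
  qed
  have "of_nat (Suc l) * (\<Sum>ks\<in>?W. of_nat (hd ks) * g ks)
    = (\<Sum>i<Suc l. \<Sum>ks\<in>?W. of_nat (hd ks) * g ks)"
    by (simp only: sum_constant card_lessThan)
  also have "\<dots> = (\<Sum>i<Suc l. \<Sum>ks\<in>?W. of_nat (ks ! i) * g ks)"
    by (intro sum.cong refl nth) simp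
  also have "\<dots> = (\<Sum>ks\<in>?W. (\<Sum>i<Suc l. of_nat (ks ! i)) * g ks)"
    by (subst sum.swap) (simp only: sum_distrib_right)
  also have "\<dots> = (\<Sum>ks\<in>?W. of_nat p * g ks)"
  proof (intro sum.cong refl)
    fix ks assume "ks \<in> ?W"
    then have "(\<Sum>i<Suc l. ks ! i) = p"
      using W[of ks] by (simp only: sum_list_sum_nth atLeast0LessThan)
    then show "(\<Sum>i<Suc l. of_nat (ks ! i)) * g ks = of_nat p * g ks"
      by (simp only: flip: of_nat_sum)
  qed
  finally show ?thesis by (simp add: sum_distrib_left)
qed

text \<open>Splits off the head \<open>p - n\<close>. The value \<open>n = 0\<close> would be a head
  \<open>p\<close>, ruled out by the bound; \<open>n = p\<close> would be a head 0, where
  \<open>h\<close> vanishes by assumption.\<close>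

lemma sum_bounded_compositions_Suc:
  fixes h :: "nat list \<Rightarrow> 'a :: comm_monoid_add"
  assumes "\<And>ks. h (0 # ks) = 0"
  shows "(\<Sum>ks\<in>bounded_compositions (Suc l) p. h ks)
    = (\<Sum>n = 1..p - 1. \<Sum>ks\<in>weak_compositions l n. h ((p - n) # ks))"
proof -
  let ?S = "SIGMA n:{1..p - 1}. weak_compositions l n"
  let ?f = "\<lambda>(n, ks). (p - n) # ks"
  let ?B = "{ks \<in> bounded_compositions (Suc l) p. hd ks \<noteq> 0}"
  have inj: "inj_on ?f ?S"
    by (auto simp: inj_on_def)
  have img: "?f ` ?S = ?B"
  proof (intro equalityI subsetI)
    fix x assume "x \<in> ?f ` ?S"
    then obtain n ks where n: "n \<in> {1..p - 1}" "ks \<in> weak_compositions l n" "x = (p - n) # ks"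
      by auto
    \<comment> \<open>The tail obeys the bound automatically: its parts are at most
      \<open>n\<close>, which is below \<open>p\<close>.\<close>
    have "k < p" if "k \<in> set ks" for k
      using member_le_sum_list[OF that] n by (auto simp: weak_compositions_def)
    then show "x \<in> ?B"
      using n by (auto simp: bounded_compositions_def weak_compositions_def)
  next
    fix x assume x: "x \<in> ?B"
    then obtain k ks where k: "x = k # ks"
      by (cases x) (auto simp: bounded_compositions_def weak_compositions_def)
    have "k \<noteq> 0" "k < p" "k + sum_list ks = p" "length ks = l"
      using x by (auto simp: k bounded_compositions_def weak_compositions_def)
    then have "(p - k, ks) \<in> ?S" "x = ?f (p - k, ks)"
      by (auto simp: k weak_compositions_def)
    then show "x \<in> ?f ` ?S" by blast
  qed
  have "(\<Sum>ks\<in>bounded_compositions (Suc l) p. h ks) = (\<Sum>ks\<in>?B. h ks)"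
  proof (rule sum.mono_neutral_right)
    show "\<forall>ks\<in>bounded_compositions (Suc l) p - ?B. h ks = 0"
    proof
      fix ks assume "ks \<in> bounded_compositions (Suc l) p - ?B"
      then show "h ks = 0"
        using assms
        by (cases ks) (auto simp: bounded_compositions_def weak_compositions_def)
    qed
  qed (auto simp: finite_bounded_compositions)
  also have "\<dots> = (\<Sum>x\<in>?S. h (?f x))"
    unfolding img[symmetric] by (rule sum.reindex_cong[OF inj refl refl])
  also have "\<dots> = (\<Sum>n = 1..p - 1. \<Sum>ks\<in>weak_compositions l n. h ((p - n) # ks))"
    by (subst sum.Sigma) (auto simp: finite_weak_compositions case_prod_unfold)
  finally show ?thesis .
qed

section \<open>The congruence\<close>

text \<open>A prime divides \<open>fact k\<close> only if it is at most \<open>k\<close>.\<close>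

lemma inverse_prod_list_fact_localized:
  assumes "prime p" "\<And>k. k \<in> set ks \<Longrightarrow> k < p"
  shows "inverse (prod_list (map fact ks)) \<in> localized_ints p"
  using assms(2)
proof (induction ks)
  case (Cons k ks)
  have "coprime (fact k) p"
    using assms(1) Cons.prems[of k]
    by (metis coprime_commute leD list.set_intros(1) prime_dvd_fact_iff prime_imp_coprime)
  then have "inverse (fact k) \<in> localized_ints p"
    using inverse_of_nat_localized[of "fact k" p] by simp
  with Cons show ?case by (auto intro: localized_ints_mult)
qed simp

text \<open>Writing n! as n (n-1)! releases a factor \<open>n ^ m\<close>, which cancels the
  denominator up to one \<open>n\<close>; the sign is absorbed into the \<open>m\<close>-th
  power.\<close>

lemma multinomial_term_eq:
  assumes "ks \<in> weak_compositions l n" "n > 0"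
  shows "(-1) ^ (m * n) / (of_nat n powi (int m - 1)) * of_nat (multinomial n ks) ^ m
    = (of_nat n * ((-1) ^ n * fact (n - 1) * inverse (prod_list (map fact ks))) ^ m :: rat)"
proof -
  let ?P = "prod_list (map fact ks) :: rat"
  \<comment> \<open>This also covers \<open>m = 0\<close>, where the exponent is -1; it relies on
    \<open>n\<close> being nonzero.\<close>
  have powi: "of_nat n powi (int m - 1) = (of_nat n ^ m / of_nat n :: rat)"
    using assms(2) by (simp add: power_int_diff)
  have "sum_list ks = n"
    using assms(1) by (simp add: weak_compositions_def)
  then have "of_nat (multinomial n ks) = fact n / ?P"
    by (rule of_nat_multinomial)
  also have "\<dots> = of_nat n * (fact (n - 1) * inverse ?P)"
    using assms(2) by (simp add: fact_reduce divide_inverse)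
  finally have mult: "of_nat (multinomial n ks) = of_nat n * (fact (n - 1) * inverse ?P)" .
  have sign: "(-1) ^ (m * n) = (((-1) ^ n) ^ m :: rat)"
    by (metis mult.commute power_mult)
  show ?thesis
    unfolding powi mult sign using assms(2) by (simp add: power_mult_distrib)
qed

text \<open>The sign \<open>(-1) ^ n\<close> inside the power is exactly the one from Wilson's
  theorem, so the right side is free of signs depending on \<open>n\<close> or
  \<open>m\<close>.\<close>

lemma multinomial_term_cong:
  assumes "prime p" "0 < n" "n < p" "ks \<in> weak_compositions l n"
  shows "rat_cong p
    ((-1) ^ (m * n) / (of_nat n powi (int m - 1)) * of_nat (multinomial n ks) ^ m)
    (- (of_nat (p - n) * inverse (prod_list (map fact ((p - n) # ks))) ^ m))"
proof -
  let ?d = "inverse (prod_list (map fact ((p - n) # ks)) :: rat)"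
  let ?P = "inverse (prod_list (map fact ks) :: rat)"
  have lt: "k < p" if "k \<in> set ((p - n) # ks)" for k
    using that assms member_le_sum_list[of k ks] by (auto simp: weak_compositions_def)
  have d: "?d \<in> localized_ints p"
    using assms(1) lt by (rule inverse_prod_list_fact_localized)
  have P: "?P \<in> localized_ints p"
    by (rule inverse_prod_list_fact_localized) (use assms(1) lt in auto)
  have "[fact (n - 1) * fact (p - n) = (-1) ^ n] (mod int p)"
    using fact_mult_fact_cong[OF assms(1), of "n - 1"] assms(2,3) by simp
  from cong_scalar_left[OF this, of "(-1) ^ n"]
  have "[(-1) ^ n * (fact (n - 1) * fact (p - n)) = 1] (mod int p)"
    by (simp flip: power_add)
  \<comment> \<open>Multiplying by \<open>?d\<close> cancels \<open>fact (p - n)\<close> on the left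
    and leaves \<open>?P\<close>.\<close>
  from rat_cong_mult_left[OF rat_cong_of_int[OF this] d]
  have 1: "rat_cong p ((-1) ^ n * fact (n - 1) * ?P) ?d"
    by (simp add: field_simps)
  have "(-1) ^ n * fact (n - 1) * ?P \<in> localized_ints p"
    using localized_ints_mult[OF of_int_localized[of "(-1) ^ n * fact (n - 1)"] P] by simp
  then have 2: "rat_cong p (((-1) ^ n * fact (n - 1) * ?P) ^ m) (?d ^ m)"
    using 1 d by (intro rat_cong_power)
  \<comment> \<open>The remaining factor \<open>n\<close> becomes minus the new part
    \<open>p - n\<close>; this is the source of the overall minus sign.\<close>
  have 3: "rat_cong p (of_int (int n)) (of_int (- int (p - n)))"
    using assms(3) by (intro rat_cong_of_int) (simp add: cong_iff_dvd_diff of_nat_diff)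
  have "rat_cong p (of_nat n * ((-1) ^ n * fact (n - 1) * ?P) ^ m)
      (of_int (- int (p - n)) * ?d ^ m)"
    using rat_cong_mult[OF 3 2] d by (simp add: localized_ints_power)
  then show ?thesis
    unfolding multinomial_term_eq[OF assms(4,2)] by simp
qed

theorem theorem1:
  fixes l m p :: nat
  assumes "l > 0"
    and "prime p"
    and "\<not> p dvd l + 1"
  shows "rat_cong p
    (\<Sum>n = 1..p - 1.
      (-1) ^ (m * n) / (of_nat n powi (int m - 1)) * of_nat (multinomial_power_sum l m n)) 0"
proof -
  let ?W = "bounded_compositions (Suc l) p"
  define g :: "nat list \<Rightarrow> rat" where "g ks = inverse (prod_list (map fact ks)) ^ m" for ks
  define T where "T = (\<Sum>ks\<in>?W. of_nat (hd ks) * g ks)"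
  \<comment> \<open>Needed so that \<open>p\<close> times this sum is congruent to 0.\<close>
  have "(\<Sum>ks\<in>?W. g ks) \<in> localized_ints p"
  proof (rule localized_ints_sum)
    fix ks assume "ks \<in> ?W"
    then show "g ks \<in> localized_ints p"
      unfolding g_def using assms(2)
      by (intro localized_ints_power inverse_prod_list_fact_localized)
        (auto simp: bounded_compositions_def)
  qed
  moreover have "of_nat (Suc l) * T = of_nat p * (\<Sum>ks\<in>?W. g ks)"
    unfolding T_def by (rule sum_hd_bounded_compositions) (simp add: g_def prod_list_map_rotate)
  ultimately have "rat_cong p (of_nat (Suc l) * T) 0"
    unfolding rat_cong_iff by auto
  \<comment> \<open>Here \<open>p\<close> not dividing \<open>l + 1\<close> enters: it makes
    \<open>l + 1\<close> invertible modulo \<open>p\<close>.\<close>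
  moreover have "coprime (Suc l) p"
    using assms(2,3) by (metis Suc_eq_plus1 coprime_commute prime_imp_coprime)
  ultimately have "rat_cong p T 0"
    by (rule rat_cong_0_cancel) simp
  from rat_cong_mult_left[OF this, of "-1"] have T0: "rat_cong p (- T) 0"
    using of_int_localized[of "-1" p] by simp
  have "rat_cong p
    (\<Sum>n = 1..p - 1. \<Sum>ks\<in>weak_compositions l n.
      (-1) ^ (m * n) / (of_nat n powi (int m - 1)) * of_nat (multinomial n ks) ^ m)
    (\<Sum>n = 1..p - 1. \<Sum>ks\<in>weak_compositions l n.
      - (of_nat (p - n) * g ((p - n) # ks)))"
    unfolding g_def
    by (intro rat_cong_sum multinomial_term_cong[OF assms(2)]) auto
  \<comment> \<open>Lists with head 0 contribute nothing to \<open>T\<close> because the head is the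
    weight.\<close>
  also have "(\<Sum>n = 1..p - 1. \<Sum>ks\<in>weak_compositions l n.
      - (of_nat (p - n) * g ((p - n) # ks))) = - T"
    unfolding T_def by (subst sum_bounded_compositions_Suc) (simp_all add: sum_negf)
  finally show ?thesis
    using rat_cong_trans[OF _ T0]
    by (simp add: multinomial_power_sum_def sum_distrib_left)
qed

end
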